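(* Suppose there exists a semi-regular $(k,n,k,\lambda)$-relative difference set in some finite abelian group. Then there exists a set of $n+1$ mutually unbiased bases of $\mathbb{C}^k$.
   Context: Let $G$ be a finite group and $N$ a normal subgroup of $G$. In the complex group algebra $\mathbb{C}[G]$ identify a subset $S\subseteq G$ with $\sum_{g\in S}g$, and write $S^{-1}=\sum_{g\in S}g^{-1}$; $1_G$ denotes the identity of $G$. A subset $D\subseteq G$ is a relative difference set (relative to $N$) if there is an integer $\lambda$ with $DD^{-1}=|D|\,1_G+\lambda\,(G\setminus N)$ in $\mathbb{C}[G]$. With $n=|N|$, $|G|=mn$ and $|D|=k$, it is called an $(m,n,k,\lambda)$-relative difference set; it is semi-regular if $m=k$. Two bases $x_1,\dots,x_d$ and $y_1,\dots,y_d$ of $\mathbb{C}^d$ are mutually unbiased if both are orthonormal and there is a constant $a$ such that $|\langle x_i,y_j\rangle|=a$ for all $i,j$ (necessarily $a=1/\sqrt d$). A set of mutually unbiased bases is a set of bases that are pairwise mutually unbiased. *)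

theory Defs
  imports
    Jordan_Normal_Form.VS_Connect
    Jordan_Normal_Form.Conjugate
    "HOL-Algebra.Coset"
    "HOL-Library.Indicator_Function"
begin

text \<open>
  An element of the complex group algebra of \<open>G\<close> is represented by its coefficient function,
  a function into the complex numbers that vanishes outside \<open>carrier G\<close>. Sums and scalar
  multiples are pointwise, a subset \<open>S\<close> of \<open>G\<close> (the sum of its elements) is
  \<open>indicator S\<close>, and the identity of \<open>G\<close> is \<open>indicator {\<one>\<^bsub>G\<^esub>}\<close>.
\<close>

text \<open>For \<open>g\<close> outside \<open>carrier G\<close> the sum is empty, so products vanish there as well.\<close>

definition group_algebra_mult ::
  "('g, 'b) monoid_scheme \<Rightarrow> ('g \<Rightarrow> complex) \<Rightarrow> ('g \<Rightarrow> complex) \<Rightarrow> ('g \<Rightarrow> complex)" where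
  "group_algebra_mult G f h =
     (\<lambda>g. \<Sum>(x, y) \<in> {(x, y). x \<in> carrier G \<and> y \<in> carrier G \<and> x \<otimes>\<^bsub>G\<^esub> y = g}. f x * h y)"

definition inverse_sum :: "('g, 'b) monoid_scheme \<Rightarrow> 'g set \<Rightarrow> ('g \<Rightarrow> complex)" where
  "inverse_sum G S = (\<lambda>x. \<Sum>g\<in>S. indicator {inv\<^bsub>G\<^esub> g} x)"

definition rds_equation ::
  "('g, 'b) monoid_scheme \<Rightarrow> 'g set \<Rightarrow> 'g set \<Rightarrow> int \<Rightarrow> bool" where
  "rds_equation G N D lam \<longleftrightarrow>
     group_algebra_mult G (indicator D) (inverse_sum G D) =
       (\<lambda>g. of_nat (card D) * indicator {\<one>\<^bsub>G\<^esub>} g + of_int lam * indicator (carrier G - N) g)"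

definition relative_difference_set ::
  "('g, 'b) monoid_scheme \<Rightarrow> 'g set \<Rightarrow> 'g set \<Rightarrow> nat \<Rightarrow> nat \<Rightarrow> nat \<Rightarrow> int \<Rightarrow> bool" where
  "relative_difference_set G N D m n k lam \<longleftrightarrow>
     group G \<and> finite (carrier G) \<and> N \<lhd> G \<and> D \<subseteq> carrier G \<and> rds_equation G N D lam \<and>
     card N = n \<and> card (carrier G) = m * n \<and> card D = k"

definition semiregular_rds ::
  "('g, 'b) monoid_scheme \<Rightarrow> 'g set \<Rightarrow> 'g set \<Rightarrow> nat \<Rightarrow> nat \<Rightarrow> nat \<Rightarrow> int \<Rightarrow> bool" where
  "semiregular_rds G N D m n k lam \<longleftrightarrow> relative_difference_set G N D m n k lam \<and> m = k"

text \<open>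
  A basis \<open>x\<^sub>1, \<dots>, x\<^sub>d\<close> of \<open>\<complex>\<^sup>d\<close> is a list of vectors, and \<open>u \<bullet>c v\<close> is the Hermitian inner
  product, linear in \<open>u\<close> and conjugate-linear in \<open>v\<close>.
\<close>

definition orthonormal_basis :: "nat \<Rightarrow> complex vec list \<Rightarrow> bool" where
  "orthonormal_basis d xs \<longleftrightarrow>
     length xs = d \<and>
     vectorspace.basis class_ring (module_vec TYPE(complex) d) (set xs) \<and>
     (\<forall>i<d. \<forall>j<d. xs ! i \<bullet>c xs ! j = (if i = j then 1 else 0))"

definition mutually_unbiased :: "nat \<Rightarrow> complex vec list \<Rightarrow> complex vec list \<Rightarrow> bool" where
  "mutually_unbiased d xs ys \<longleftrightarrow>
     orthonormal_basis d xs \<and> orthonormal_basis d ys \<and>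
     (\<exists>a::real. \<forall>i<d. \<forall>j<d. cmod (xs ! i \<bullet>c ys ! j) = a)"

text \<open>
  For \<open>d \<ge> 2\<close> no orthonormal basis is mutually unbiased with a reordering of itself, so distinct
  lists in such a set are distinct as unordered bases; for \<open>d = 1\<close> there is nothing to reorder.
\<close>

definition mub_set :: "nat \<Rightarrow> complex vec list set \<Rightarrow> bool" where
  "mub_set d \<B> \<longleftrightarrow>
     (\<forall>xs\<in>\<B>. orthonormal_basis d xs) \<and> pairwise (mutually_unbiased d) \<B>"

end

theory Submission
  imports Defs "HOL-Algebra.Multiplicative_Group"
begin

text \<open>
  Restrict the characters \<open>\<chi>\<close> of \<open>G\<close> to \<open>D\<close> and scale by \<open>1 / sqrt k\<close>, giving unit vectors of
  \<open>\<complex>\<^sup>k\<close>. The inner product of two of them is \<open>\<phi>(D) / k\<close>, where \<open>\<phi>\<close> is the quotient of the two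
  characters, and the difference set equation gives
  \<open>|\<phi>(D)|\<^sup>2 = k + lam (\<phi>(G) - \<phi>(N))\<close>. For nontrivial \<open>\<phi>\<close> this is \<open>k\<close> if \<open>\<phi>\<close> is nontrivial on \<open>N\<close>,
  and \<open>k - lam n = 0\<close> otherwise. Hence each of the \<open>n\<close> classes of \<open>k\<close> characters with a common
  restriction to \<open>N\<close> yields an orthonormal basis, these bases are mutually unbiased, and the
  standard basis is unbiased to all of them because characters have modulus 1.
\<close>

section \<open>Characters of finite abelian groups\<close>

text \<open>Stated relative to \<open>H\<close> so that characters can be extended one subgroup at a
  time. On a subgroup of a finite group, the value 1 at the identity forces all values to be roots
  of unity.\<close>

definition character_on :: "('g, 'b) monoid_scheme \<Rightarrow> 'g set \<Rightarrow> ('g \<Rightarrow> complex) \<Rightarrow> bool" where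
  "character_on G H \<chi> \<longleftrightarrow> \<chi> \<one>\<^bsub>G\<^esub> = 1 \<and> (\<forall>x\<in>H. \<forall>y\<in>H. \<chi> (x \<otimes>\<^bsub>G\<^esub> y) = \<chi> x * \<chi> y)"

text \<open>The value 0 outside the carrier makes characters that agree on \<open>G\<close> equal as
  functions, so that they can be counted.\<close>

definition characters :: "('g, 'b) monoid_scheme \<Rightarrow> ('g \<Rightarrow> complex) set" where
  "characters G = {\<chi>. character_on G (carrier G) \<chi> \<and> (\<forall>x. x \<notin> carrier G \<longrightarrow> \<chi> x = 0)}"

lemma character_on_one: "character_on G H \<chi> \<Longrightarrow> \<chi> \<one>\<^bsub>G\<^esub> = 1"
  by (simp add: character_on_def)

lemma character_on_mult:
  "character_on G H \<chi> \<Longrightarrow> x \<in> H \<Longrightarrow> y \<in> H \<Longrightarrow> \<chi> (x \<otimes>\<^bsub>G\<^esub> y) = \<chi> x * \<chi> y"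
  by (simp add: character_on_def)

lemma norm_root_of_unity:
  fixes z :: complex
  assumes "z ^ m = 1" "0 < m"
  shows "cmod z = 1"
proof -
  have "cmod z ^ m = 1" using assms by (simp flip: norm_power)
  thus ?thesis using assms power_eq_1_iff[of "cmod z" m] by simp
qed

locale finite_abelian_group = comm_group G for G (structure) +
  assumes fin [simp]: "finite (carrier G)"
begin

section \<open>Values of characters on subgroups\<close>

lemma pow_in_subgroup: "subgroup H G \<Longrightarrow> x \<in> H \<Longrightarrow> x [^] (i::nat) \<in> H"
  by (induction i) (auto simp: subgroup.one_closed subgroup.m_closed)

lemma character_on_pow:
  assumes "subgroup H G" "character_on G H \<chi>" "x \<in> H"
  shows "\<chi> (x [^] (i::nat)) = \<chi> x ^ i"
  using assms
  by (induction i) (auto simp: character_on_one character_on_mult pow_in_subgroup)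

text \<open>The power of \<open>x\<close> with exponent |G| is the identity, so the value at
  \<open>x\<close> is a root of unity.\<close>

lemma character_on_norm:
  assumes H: "subgroup H G" and \<chi>: "character_on G H \<chi>" and x: "x \<in> H"
  shows "cmod (\<chi> x) = 1"
proof -
  have xG: "x \<in> carrier G" using H x by (rule subgroup.mem_carrier)
  have "\<chi> x ^ Coset.order G = 1"
    using character_on_pow[OF assms, of "Coset.order G"] pow_order_eq_1[OF xG] character_on_one[OF \<chi>]
    by simp
  moreover have "Coset.order G > 0" by (simp add: order_gt_0_iff_finite)
  ultimately show ?thesis by (rule norm_root_of_unity)
qed

lemma character_on_inv:
  assumes H: "subgroup H G" and \<chi>: "character_on G H \<chi>" and x: "x \<in> H"
  shows "\<chi> (inv x) = cnj (\<chi> x)"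
proof -
  have xG: "x \<in> carrier G" using H x by (rule subgroup.mem_carrier)
  have "\<chi> x * \<chi> (inv x) = 1"
    using character_on_mult[OF \<chi> x subgroup.m_inv_closed[OF H x]] xG character_on_one[OF \<chi>]
    by simp
  moreover have "\<chi> x * cnj (\<chi> x) = 1"
    using character_on_norm[OF assms] complex_norm_square[of "\<chi> x"] by simp
  ultimately show ?thesis by (metis mult_cancel_left mult_zero_left zero_neq_one)
qed

section \<open>Extension of characters to larger subgroups\<close>

text \<open>On the product of \<open>H\<close> and the subgroup generated by \<open>g\<close>, send
  h g^i to \<chi>(h) z^i; the assumption on \<open>z\<close> is what makes this well defined.
  Leaving \<open>z\<close> free lets \<open>character_separates\<close> prescribe a value other than
  1.\<close>

lemma extend_character_step:
  assumes H: "subgroup H G" and \<chi>: "character_on G H \<chi>" and g: "g \<in> carrier G"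
    and z: "\<And>i::nat. g [^] i \<in> H \<Longrightarrow> \<chi> (g [^] i) = z ^ i"
  shows "\<exists>K \<psi>. subgroup K G \<and> H \<subseteq> K \<and> g \<in> K \<and> character_on G K \<psi> \<and> (\<forall>x\<in>H. \<psi> x = \<chi> x) \<and> \<psi> g = z"
proof -
  define K where "K = H <#> generate G {g}"
  have HG: "\<And>h. h \<in> H \<Longrightarrow> h \<in> carrier G" using H by (rule subgroup.mem_carrier)
  have K: "subgroup K G" unfolding K_def
    by (intro mult_subgroups H generate_is_subgroup) (use g in auto)
  \<comment> \<open>In a finite group the powers with natural exponents exhaust the subgroup
    generated by \<open>g\<close>.\<close>
  have K_iff: "x \<in> K \<longleftrightarrow> (\<exists>h\<in>H. \<exists>i::nat. x = h \<otimes> g [^] i)" for x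
    unfolding K_def set_mult_def generate_pow_on_finite_carrier[OF fin g] by auto
  \<comment> \<open>Cancelling the smaller power of \<open>g\<close> leaves g^(j - i) in
    \<open>H\<close>, where the assumption on \<open>z\<close> applies.\<close>
  have wd_le: "\<chi> h * z ^ i = \<chi> h' * z ^ j"
    if h: "h \<in> H" "h' \<in> H" and eq: "h \<otimes> g [^] i = h' \<otimes> g [^] j" and le: "i \<le> j"
    for h h' and i j :: nat
  proof -
    have "h \<otimes> g [^] i = (h' \<otimes> g [^] (j - i)) \<otimes> g [^] i"
      using h HG g le eq by (simp add: m_assoc nat_pow_mult)
    hence eq': "h = h' \<otimes> g [^] (j - i)" using h HG g by simp
    hence "g [^] (j - i) = inv h' \<otimes> h" using h HG g by (simp add: inv_solve_left)
    hence mem: "g [^] (j - i) \<in> H" using h H by (simp add: subgroup.m_closed subgroup.m_inv_closed)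
    have "\<chi> h = \<chi> h' * z ^ (j - i)"
      using eq' character_on_mult[OF \<chi> h(2) mem] z[OF mem] by simp
    thus ?thesis using le by (simp add: power_add[symmetric] mult.assoc)
  qed
  have wd: "\<chi> h * z ^ i = \<chi> h' * z ^ j"
    if "h \<in> H" "h' \<in> H" "h \<otimes> g [^] i = h' \<otimes> g [^] j" for h h' and i j :: nat
    using wd_le[of h h' i j] wd_le[of h' h j i] that by (metis nat_le_linear)
  \<comment> \<open>By \<open>wd\<close> the value does not depend on the representation
    chosen.\<close>
  define \<psi> where "\<psi> x = (SOME c. \<exists>h\<in>H. \<exists>i::nat. x = h \<otimes> g [^] i \<and> c = \<chi> h * z ^ i)" for x
  have \<psi>: "\<psi> (h \<otimes> g [^] i) = \<chi> h * z ^ i" if "h \<in> H" for h and i :: nat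
    unfolding \<psi>_def
  proof (rule some_equality)
    show "\<exists>h'\<in>H. \<exists>j::nat. h \<otimes> g [^] i = h' \<otimes> g [^] j \<and> \<chi> h * z ^ i = \<chi> h' * z ^ j"
      using that by blast
    fix c assume "\<exists>h'\<in>H. \<exists>j::nat. h \<otimes> g [^] i = h' \<otimes> g [^] j \<and> c = \<chi> h' * z ^ j"
    then obtain h' and j :: nat where "h' \<in> H" "h \<otimes> g [^] i = h' \<otimes> g [^] j" "c = \<chi> h' * z ^ j"
      by blast
    thus "c = \<chi> h * z ^ i" using wd[OF that, of h' i j] by simp
  qed
  have one: "\<one> \<in> H" using H by (rule subgroup.one_closed)
  have ext: "\<psi> h = \<chi> h" if "h \<in> H" for h
    using \<psi>[OF that, of 0] HG[OF that] by simp
  have "\<psi> g = z" using \<psi>[OF one, of 1] g character_on_one[OF \<chi>] by simp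
  moreover have "character_on G K \<psi>" unfolding character_on_def
  proof (intro conjI ballI)
    show "\<psi> \<one> = 1" using ext[OF one] character_on_one[OF \<chi>] by simp
    fix x y assume "x \<in> K" "y \<in> K"
    then obtain h h' and i j :: nat where hh: "h \<in> H" "h' \<in> H"
      and xy: "x = h \<otimes> g [^] i" "y = h' \<otimes> g [^] j" unfolding K_iff by blast
    have "x \<otimes> y = (h \<otimes> h') \<otimes> (g [^] i \<otimes> g [^] j)"
      using hh HG g unfolding xy by (simp add: m_ac)
    also have "g [^] i \<otimes> g [^] j = g [^] (i + j)" using g by (simp add: nat_pow_mult)
    finally have "\<psi> (x \<otimes> y) = \<chi> (h \<otimes> h') * z ^ (i + j)"
      using \<psi> H hh by (simp add: subgroup.m_closed)
    also have "\<dots> = \<psi> x * \<psi> y"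
      unfolding xy using \<psi> hh character_on_mult[OF \<chi> hh] by (simp add: power_add)
    finally show "\<psi> (x \<otimes> y) = \<psi> x * \<psi> y" .
  qed
  moreover have "H \<subseteq> K"
  proof
    fix h assume h: "h \<in> H"
    hence "h = h \<otimes> g [^] (0::nat)" using HG by simp
    thus "h \<in> K" unfolding K_iff using h by blast
  qed
  moreover have "g \<in> K"
  proof -
    have "g = \<one> \<otimes> g [^] (1::nat)" using g by simp
    thus ?thesis unfolding K_iff using one by blast
  qed
  ultimately show ?thesis using K ext by blast
qed

text \<open>Let \<open>r\<close> be the least positive exponent with g^r in \<open>H\<close>. All
  exponents i with g^i in \<open>H\<close> are multiples of \<open>r\<close>, so any
  \<open>r\<close>-th root of the value at g^r will do.\<close>

lemma character_value_exists:
  assumes H: "subgroup H G" and \<chi>: "character_on G H \<chi>" and g: "g \<in> carrier G"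
  obtains z where "\<And>i::nat. g [^] i \<in> H \<Longrightarrow> \<chi> (g [^] i) = z ^ i"
proof -
  define r where "r = (LEAST r::nat. r > 0 \<and> g [^] r \<in> H)"
  have "Coset.order G > 0 \<and> g [^] Coset.order G \<in> H"
    using pow_order_eq_1[OF g] subgroup.one_closed[OF H] by (simp add: order_gt_0_iff_finite)
  hence r: "r > 0 \<and> g [^] r \<in> H" unfolding r_def by (rule LeastI)
  \<comment> \<open>A nonzero complex number has \<open>r\<close> distinct \<open>r\<close>-th
    roots, hence at least one.\<close>
  have "\<chi> (g [^] r) \<noteq> 0" using character_on_norm[OF H \<chi>, of "g [^] r"] r by auto
  hence "card {z. z ^ r = \<chi> (g [^] r)} = r" using r by (intro card_nth_roots) auto
  hence "{z. z ^ r = \<chi> (g [^] r)} \<noteq> {}" using r by (metis card.empty less_irrefl)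
  then obtain z where z: "z ^ r = \<chi> (g [^] r)" by blast
  have "\<chi> (g [^] i) = z ^ i" if i: "g [^] i \<in> H" for i :: nat
  proof -
    have rq: "g [^] (r * q) \<in> H" for q using pow_in_subgroup[OF H, of "g [^] r" q] r g
      by (simp add: nat_pow_pow)
    have "g [^] i = g [^] (r * (i div r)) \<otimes> g [^] (i mod r)" using g by (simp add: nat_pow_mult)
    hence "g [^] (i mod r) = inv (g [^] (r * (i div r))) \<otimes> g [^] i"
      using g by (simp add: inv_solve_left)
    hence "g [^] (i mod r) \<in> H" using i rq H by (simp add: subgroup.m_closed subgroup.m_inv_closed)
    \<comment> \<open>A positive remainder would contradict the minimality of
      \<open>r\<close>.\<close>
    hence "i mod r = 0"
      using r not_less_Least[of "i mod r" "\<lambda>r. r > 0 \<and> g [^] r \<in> H"] unfolding r_def[symmetric]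
      by auto
    then obtain q where q: "i = r * q" by blast
    have "\<chi> (g [^] i) = \<chi> ((g [^] r) [^] q)" unfolding q using g by (simp add: nat_pow_pow)
    also have "\<dots> = z ^ i" using character_on_pow[OF H \<chi>] r by (simp add: z[symmetric] q power_mult)
    finally show ?thesis .
  qed
  thus thesis by (rule that)
qed

text \<open>Adjoin one element at a time; the induction is on the number of elements outside
  \<open>H\<close>.\<close>

lemma extend_character:
  assumes "subgroup H G" "character_on G H \<chi>"
  shows "\<exists>\<psi>. character_on G (carrier G) \<psi> \<and> (\<forall>x\<in>H. \<psi> x = \<chi> x)"
  using assms
proof (induction "card (carrier G - H)" arbitrary: H \<chi> rule: less_induct)
  case less
  note H = less.prems(1) and \<chi> = less.prems(2)
  have sub: "H \<subseteq> carrier G" using H by (rule subgroup.subset)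
  show ?case
  proof (cases "H = carrier G")
    case True
    thus ?thesis using \<chi> by auto
  next
    case False
    then obtain g where g: "g \<in> carrier G" "g \<notin> H" using sub by blast
    obtain z where "\<And>i::nat. g [^] i \<in> H \<Longrightarrow> \<chi> (g [^] i) = z ^ i"
      using character_value_exists[OF H \<chi> g(1)] by blast
    from extend_character_step[OF H \<chi> g(1) this] obtain K \<psi> where
      K: "subgroup K G" "H \<subseteq> K" "g \<in> K" "character_on G K \<psi>" "\<And>x. x \<in> H \<Longrightarrow> \<psi> x = \<chi> x" by blast
    have "card (carrier G - K) < card (carrier G - H)"
      by (rule psubset_card_mono) (use K g in auto)
    from less.hyps[OF this K(1,4)] obtain \<phi> where
      "character_on G (carrier G) \<phi>" "\<And>x. x \<in> K \<Longrightarrow> \<phi> x = \<psi> x" by blast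
    thus ?thesis using K by (intro exI[of _ \<phi>]) auto
  qed
qed

text \<open>Starting from the trivial subgroup, \<open>g\<close> may be sent to any root of unity of
  order dividing \<open>ord g\<close>; as \<open>ord g\<close> is at least 2, some such root differs
  from 1.\<close>

lemma character_separates:
  assumes g: "g \<in> carrier G" "g \<noteq> \<one>"
  shows "\<exists>\<chi>\<in>characters G. \<chi> g \<noteq> 1"
proof -
  have "ord g > 0" using ord_ge_1[OF fin g(1)] by simp
  moreover have "ord g \<noteq> 1" using ord_eq_1[OF g(1)] g(2) by simp
  ultimately have o: "ord g > 0" "ord g \<ge> 2" by auto
  have "{z::complex. z ^ ord g = 1} \<noteq> {1}"
    using card_nth_roots[of 1 "ord g"] o by auto
  moreover have "1 \<in> {z::complex. z ^ ord g = 1}" by simp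
  ultimately obtain z :: complex where z: "z ^ ord g = 1" "z \<noteq> 1" by blast
  have "(1::complex) = z ^ i" if "g [^] i \<in> {\<one>}" for i :: nat
  proof -
    have "ord g dvd i" using that pow_eq_id[OF g(1)] by simp
    thus ?thesis using z by (auto simp: power_mult elim!: dvdE)
  qed
  moreover have triv: "subgroup {\<one>} G" by (rule triv_subgroup)
  ultimately obtain K \<psi> where K: "subgroup K G" "g \<in> K" "character_on G K \<psi>" "\<psi> g = z"
    using extend_character_step[OF triv _ g(1), of "\<lambda>_. 1" z] by (auto simp: character_on_def)
  obtain \<phi> where \<phi>: "character_on G (carrier G) \<phi>" "\<forall>x\<in>K. \<phi> x = \<psi> x"
    using extend_character[OF K(1,3)] by blast
  \<comment> \<open>Truncate to 0 outside the carrier, as membership in \<open>characters\<close>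
    demands.\<close>
  let ?\<chi> = "\<lambda>x. if x \<in> carrier G then \<phi> x else 0"
  have "?\<chi> \<in> characters G" using \<phi>(1) by (auto simp: characters_def character_on_def)
  moreover have "?\<chi> g \<noteq> 1" using \<phi> K z g by simp
  ultimately show ?thesis by (intro bexI[of _ ?\<chi>])
qed

section \<open>Characters of the whole group under pointwise multiplication\<close>

lemma characters_on: "\<chi> \<in> characters G \<Longrightarrow> character_on G (carrier G) \<chi>"
  by (simp add: characters_def)

lemma characters_outside: "\<chi> \<in> characters G \<Longrightarrow> x \<notin> carrier G \<Longrightarrow> \<chi> x = 0"
  by (simp add: characters_def)

lemma characters_norm: "\<chi> \<in> characters G \<Longrightarrow> x \<in> carrier G \<Longrightarrow> cmod (\<chi> x) = 1"
  using character_on_norm[OF subgroup_self] characters_on by blast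

lemma characters_cnj: "\<chi> \<in> characters G \<Longrightarrow> x \<in> carrier G \<Longrightarrow> \<chi> x * cnj (\<chi> x) = 1"
  using characters_norm[of \<chi> x] complex_norm_square[of "\<chi> x"] by simp

lemma characters_eqI:
  assumes "\<chi> \<in> characters G" "\<psi> \<in> characters G" "\<And>x. x \<in> carrier G \<Longrightarrow> \<chi> x = \<psi> x"
  shows "\<chi> = \<psi>"
  using assms by (intro ext) (metis characters_outside)

lemma characters_mult:
  assumes "\<chi> \<in> characters G" "\<psi> \<in> characters G"
  shows "(\<lambda>x. \<chi> x * \<psi> x) \<in> characters G"
  using assms by (auto simp: characters_def character_on_def)

lemma characters_cnj_closed:
  assumes "\<chi> \<in> characters G"
  shows "(\<lambda>x. cnj (\<chi> x)) \<in> characters G"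
  using assms by (auto simp: characters_def character_on_def)

text \<open>Every value on the carrier is a root of unity of order dividing |G|, which leaves
  finitely many functions.\<close>

lemma finite_characters: "finite (characters G)"
proof -
  have pos: "Coset.order G > 0" by (simp add: order_gt_0_iff_finite)
  have "\<chi> x ^ Coset.order G = 1" if "\<chi> \<in> characters G" "x \<in> carrier G" for \<chi> x
    using character_on_pow[OF subgroup_self characters_on[OF that(1)] that(2), of "Coset.order G"]
      pow_order_eq_1[OF that(2)] character_on_one[OF characters_on[OF that(1)]] by simp
  hence "characters G \<subseteq> {f. \<forall>x. (x \<in> carrier G \<longrightarrow> f x \<in> {z. z ^ Coset.order G = 1}) \<and>
      (x \<notin> carrier G \<longrightarrow> f x = 0)}"
    by (auto simp: characters_outside)
  moreover have "finite \<dots>"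
    by (rule finite_set_of_finite_funs) (use pos finite_nth_roots in auto)
  ultimately show ?thesis by (rule finite_subset)
qed

section \<open>Orthogonality relations and counting of characters\<close>

text \<open>Translation by an \<open>h\<close> in \<open>H\<close> with value other than 1 permutes
  \<open>H\<close> and multiplies the sum by that value, so the sum vanishes.\<close>

lemma sum_character_subgroup:
  assumes H: "subgroup H G" and \<chi>: "\<chi> \<in> characters G"
  shows "(\<Sum>x\<in>H. \<chi> x) = (if \<forall>x\<in>H. \<chi> x = 1 then of_nat (card H) else 0)"
proof (cases "\<forall>x\<in>H. \<chi> x = 1")
  case False
  then obtain h where h: "h \<in> H" "\<chi> h \<noteq> 1" by blast
  have HG: "\<And>h. h \<in> H \<Longrightarrow> h \<in> carrier G" using H by (rule subgroup.mem_carrier)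
  have "bij_betw (\<lambda>x. h \<otimes> x) H H"
    by (rule bij_betwI[where g = "\<lambda>x. inv h \<otimes> x"])
      (use h H HG in \<open>auto simp: subgroup.m_closed subgroup.m_inv_closed m_assoc[symmetric]\<close>)
  hence "(\<Sum>x\<in>H. \<chi> x) = (\<Sum>x\<in>H. \<chi> (h \<otimes> x))" by (rule sum.reindex_bij_betw[symmetric])
  also have "\<dots> = \<chi> h * (\<Sum>x\<in>H. \<chi> x)"
    using character_on_mult[OF characters_on[OF \<chi>]] h HG by (simp add: sum_distrib_left)
  finally show ?thesis using h False by auto
qed simp

text \<open>The dual argument: multiplication by a character that separates \<open>x\<close> from
  the identity permutes the characters.\<close>

lemma sum_characters_at:
  assumes x: "x \<in> carrier G"
  shows "(\<Sum>\<chi>\<in>characters G. \<chi> x) = (if x = \<one> then of_nat (card (characters G)) else 0)"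
proof (cases "x = \<one>")
  case True
  have "(\<Sum>\<chi>\<in>characters G. \<chi> x) = (\<Sum>\<chi>\<in>characters G. 1)"
    using True character_on_one[OF characters_on] by (intro sum.cong) auto
  thus ?thesis using True by simp
next
  case False
  then obtain \<psi> where \<psi>: "\<psi> \<in> characters G" "\<psi> x \<noteq> 1" using character_separates[OF x] by blast
  have "bij_betw (\<lambda>\<chi> x. \<psi> x * \<chi> x) (characters G) (characters G)"
  proof (rule bij_betwI[where g = "\<lambda>\<chi> x. cnj (\<psi> x) * \<chi> x"])
    show "(\<lambda>\<chi> x. \<psi> x * \<chi> x) \<in> characters G \<rightarrow> characters G"
      "(\<lambda>\<chi> x. cnj (\<psi> x) * \<chi> x) \<in> characters G \<rightarrow> characters G"
      using characters_mult characters_cnj_closed \<psi>(1) by blast+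
  next
    fix \<chi> assume \<chi>: "\<chi> \<in> characters G"
    show "(\<lambda>x. cnj (\<psi> x) * (\<psi> x * \<chi> x)) = \<chi>" "(\<lambda>x. \<psi> x * (cnj (\<psi> x) * \<chi> x)) = \<chi>"
      by (rule characters_eqI;
          use \<chi> \<psi>(1) in \<open>simp add: characters_mult characters_cnj_closed mult.assoc[symmetric]
            characters_cnj mult.commute[of "cnj (\<psi> _)"]\<close>)+
  qed
  hence "(\<Sum>\<chi>\<in>characters G. \<chi> x) = (\<Sum>\<chi>\<in>characters G. \<psi> x * \<chi> x)"
    by (rule sum.reindex_bij_betw[symmetric, where g = "\<lambda>\<chi>. \<chi> x"])
  also have "\<dots> = \<psi> x * (\<Sum>\<chi>\<in>characters G. \<chi> x)" by (simp add: sum_distrib_left)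
  finally show ?thesis using \<psi> False by auto
qed

text \<open>Both sides count the sum of \<open>\<chi> x\<close> over all characters \<open>\<chi>\<close> and all \<open>x \<in> H\<close>.\<close>

lemma card_annihilator:
  assumes H: "subgroup H G"
  shows "card H * card {\<chi>\<in>characters G. \<forall>x\<in>H. \<chi> x = 1} = card (characters G)"
proof -
  have HG: "\<And>h. h \<in> H \<Longrightarrow> h \<in> carrier G" using H by (rule subgroup.mem_carrier)
  have finH: "finite H" using HG fin by (meson finite_subset subsetI)
  have "of_nat (card (characters G)) = (\<Sum>x\<in>H. \<Sum>\<chi>\<in>characters G. \<chi> x)"
    using finH subgroup.one_closed[OF H] HG by (simp add: sum_characters_at sum.delta)
  also have "\<dots> = (\<Sum>\<chi>\<in>characters G. \<Sum>x\<in>H. \<chi> x)" by (rule sum.swap)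
  also have "\<dots> = (\<Sum>\<chi>\<in>characters G. if \<forall>x\<in>H. \<chi> x = 1 then of_nat (card H) else 0)"
    using sum_character_subgroup[OF H] by simp
  also have "\<dots> = of_nat (card H * card {\<chi>\<in>characters G. \<forall>x\<in>H. \<chi> x = 1})"
    using finite_characters by (simp add: sum.If_cases Int_def)
  finally show ?thesis by (simp only: of_nat_eq_iff)
qed

text \<open>The case \<open>H = carrier G\<close> of \<open>card_annihilator\<close>: only the
  trivial character is 1 on all of \<open>G\<close>.\<close>

lemma card_characters: "card (characters G) = card (carrier G)"
proof -
  let ?e = "\<lambda>x. if x \<in> carrier G then 1 else (0::complex)"
  have e: "?e \<in> characters G" by (auto simp: characters_def character_on_def)
  have "{\<chi>\<in>characters G. \<forall>x\<in>carrier G. \<chi> x = 1} = {?e}"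
    using e by (auto intro!: characters_eqI)
  thus ?thesis using card_annihilator[OF subgroup_self] by simp
qed

text \<open>The class of \<chi> is a coset of the annihilator of \<open>H\<close>: multiplication by
  \<chi> and by its conjugate are inverse bijections.\<close>

lemma card_restriction_class:
  assumes H: "subgroup H G" and \<chi>: "\<chi> \<in> characters G"
  shows "card H * card {\<psi>\<in>characters G. \<forall>x\<in>H. \<psi> x = \<chi> x} = card (carrier G)"
proof -
  have HG: "\<And>h. h \<in> H \<Longrightarrow> h \<in> carrier G" using H by (rule subgroup.mem_carrier)
  have "bij_betw (\<lambda>\<psi> x. \<chi> x * \<psi> x) {\<psi>\<in>characters G. \<forall>x\<in>H. \<psi> x = 1}
      {\<psi>\<in>characters G. \<forall>x\<in>H. \<psi> x = \<chi> x}"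
  proof (rule bij_betwI[where g = "\<lambda>\<psi> x. cnj (\<chi> x) * \<psi> x"])
    show "(\<lambda>\<psi> x. \<chi> x * \<psi> x) \<in> {\<psi>\<in>characters G. \<forall>x\<in>H. \<psi> x = 1} \<rightarrow>
        {\<psi>\<in>characters G. \<forall>x\<in>H. \<psi> x = \<chi> x}"
      using characters_mult \<chi> by auto
    show "(\<lambda>\<psi> x. cnj (\<chi> x) * \<psi> x) \<in> {\<psi>\<in>characters G. \<forall>x\<in>H. \<psi> x = \<chi> x} \<rightarrow>
        {\<psi>\<in>characters G. \<forall>x\<in>H. \<psi> x = 1}"
      using characters_mult characters_cnj_closed[OF \<chi>] characters_cnj[OF \<chi>] HG
      by (auto simp: mult.commute)
  next
    fix \<psi>
    show "\<psi> \<in> {\<psi>\<in>characters G. \<forall>x\<in>H. \<psi> x = 1} \<Longrightarrow> (\<lambda>x. cnj (\<chi> x) * (\<chi> x * \<psi> x)) = \<psi>"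
      "\<psi> \<in> {\<psi>\<in>characters G. \<forall>x\<in>H. \<psi> x = \<chi> x} \<Longrightarrow> (\<lambda>x. \<chi> x * (cnj (\<chi> x) * \<psi> x)) = \<psi>"
      by (rule characters_eqI;
          use \<chi> in \<open>simp add: characters_mult characters_cnj_closed mult.assoc[symmetric]
            characters_cnj mult.commute[of "cnj (\<chi> _)"]\<close>)+
  qed
  hence "card {\<psi>\<in>characters G. \<forall>x\<in>H. \<psi> x = \<chi> x} = card {\<psi>\<in>characters G. \<forall>x\<in>H. \<psi> x = 1}"
    by (simp add: bij_betw_same_card)
  thus ?thesis using card_annihilator[OF H] card_characters by simp
qed

text \<open>The |G| characters are partitioned into classes of the common size |G| / |H|.\<close>

lemma card_restriction_classes:
  assumes H: "subgroup H G"
  shows "card ((\<lambda>\<chi>. {\<psi>\<in>characters G. \<forall>x\<in>H. \<psi> x = \<chi> x}) ` characters G) = card H"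
    (is "card (?c ` _) = _")
proof -
  have "finite H" using subgroup.subset[OF H] fin by (rule finite_subset)
  hence posH: "card H > 0" using subgroup.one_closed[OF H] by (auto simp: card_gt_0_iff)
  obtain q where q: "card (carrier G) = card H * q" "q > 0"
  proof -
    have "characters G \<noteq> {}" using card_characters fin one_closed by force
    then obtain \<chi> where "\<chi> \<in> characters G" by blast
    note c = card_restriction_class[OF H this, symmetric]
    moreover have "card (carrier G) > 0" using fin one_closed by (auto simp: card_gt_0_iff)
    ultimately show thesis by (intro that[OF c]) (simp only: zero_less_mult_iff, auto)
  qed
  have each: "card (?c \<chi>) = q" if "\<chi> \<in> characters G" for \<chi>
    using card_restriction_class[OF H that] q posH by simp
  have "q * card (?c ` characters G) = card (\<Union>(?c ` characters G))"
  proof (rule card_partition)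
    fix A B assume "A \<in> ?c ` characters G" "B \<in> ?c ` characters G" "A \<noteq> B"
    thus "A \<inter> B = {}" by auto
  qed (use finite_characters each in auto)
  also have "\<Union>(?c ` characters G) = characters G" by blast
  finally show ?thesis using card_characters q by simp
qed

subsection \<open>Character sums in the group algebra\<close>

text \<open>The linear extension of a character to the group algebra is multiplicative; the proof
  groups pairs by their product.\<close>

lemma sum_group_algebra_mult:
  assumes \<chi>: "\<chi> \<in> characters G"
  shows "(\<Sum>g\<in>carrier G. group_algebra_mult G f h g * \<chi> g) =
    (\<Sum>x\<in>carrier G. f x * \<chi> x) * (\<Sum>y\<in>carrier G. h y * \<chi> y)"
proof -
  let ?P = "carrier G \<times> carrier G"
  have eq: "{(x, y). x \<in> carrier G \<and> y \<in> carrier G \<and> x \<otimes> y = g} = {p \<in> ?P. fst p \<otimes> snd p = g}" for g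
    by auto
  have "(\<Sum>g\<in>carrier G. group_algebra_mult G f h g * \<chi> g) =
      (\<Sum>g\<in>carrier G. \<Sum>p\<in>{p \<in> ?P. fst p \<otimes> snd p = g}. f (fst p) * h (snd p) * \<chi> (fst p \<otimes> snd p))"
    unfolding group_algebra_mult_def eq
    by (auto simp: sum_distrib_right case_prod_beta intro!: sum.cong)
  also have "\<dots> = (\<Sum>p\<in>?P. f (fst p) * h (snd p) * \<chi> (fst p \<otimes> snd p))"
    by (rule sum.group) auto
  also have "\<dots> = (\<Sum>(x, y)\<in>?P. (f x * \<chi> x) * (h y * \<chi> y))"
    using character_on_mult[OF characters_on[OF \<chi>]] by (auto intro!: sum.cong)
  also have "\<dots> = (\<Sum>x\<in>carrier G. f x * \<chi> x) * (\<Sum>y\<in>carrier G. h y * \<chi> y)"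
    by (simp add: sum_product sum.cartesian_product)
  finally show ?thesis .
qed

lemma sum_indicator_mult:
  assumes "S \<subseteq> carrier G"
  shows "(\<Sum>x\<in>carrier G. indicator S x * \<chi> x) = (\<Sum>x\<in>S. \<chi> x :: complex)"
proof -
  have "(\<Sum>x\<in>carrier G. indicator S x * \<chi> x) = (\<Sum>x\<in>carrier G \<inter> S. \<chi> x)"
    by (simp add: indicator_def if_distrib[of "\<lambda>c. c * _"] sum.If_cases cong: if_cong)
  also have "carrier G \<inter> S = S" using assms by auto
  finally show ?thesis .
qed

text \<open>Characters turn inverses into conjugates.\<close>

lemma sum_inverse_sum:
  assumes "S \<subseteq> carrier G" "\<chi> \<in> characters G"
  shows "(\<Sum>x\<in>carrier G. inverse_sum G S x * \<chi> x) = cnj (\<Sum>x\<in>S. \<chi> x)"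
proof -
  have "(\<Sum>x\<in>carrier G. inverse_sum G S x * \<chi> x) =
      (\<Sum>g\<in>S. \<Sum>x\<in>carrier G. indicator {inv g} x * \<chi> x)"
    unfolding inverse_sum_def sum_distrib_right by (rule sum.swap)
  also have "\<dots> = (\<Sum>g\<in>S. \<chi> (inv g))"
    using assms by (intro sum.cong refl, subst sum_indicator_mult) auto
  also have "\<dots> = (\<Sum>g\<in>S. cnj (\<chi> g))"
    using assms character_on_inv[OF subgroup_self characters_on[OF assms(2)]]
    by (intro sum.cong) auto
  finally show ?thesis by simp
qed

text \<open>Applying the character to the difference set equation turns its left side into the
  squared modulus of the sum over \<open>D\<close>.\<close>

lemma rds_character_sum:
  assumes rds: "rds_equation G N D lam" and N: "subgroup N G" and D: "D \<subseteq> carrier G"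
    and \<chi>: "\<chi> \<in> characters G"
  shows "(\<Sum>x\<in>D. \<chi> x) * cnj (\<Sum>x\<in>D. \<chi> x) =
    of_nat (card D) + of_int lam * ((\<Sum>x\<in>carrier G. \<chi> x) - (\<Sum>x\<in>N. \<chi> x))"
proof -
  have NG: "N \<subseteq> carrier G" using N by (rule subgroup.subset)
  have "(\<Sum>x\<in>D. \<chi> x) * cnj (\<Sum>x\<in>D. \<chi> x) =
      (\<Sum>g\<in>carrier G. group_algebra_mult G (indicator D) (inverse_sum G D) g * \<chi> g)"
    unfolding sum_group_algebra_mult[OF \<chi>] sum_inverse_sum[OF D \<chi>] sum_indicator_mult[OF D] ..
  also have "\<dots> = of_nat (card D) * (\<Sum>g\<in>carrier G. indicator {\<one>} g * \<chi> g) +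
      of_int lam * (\<Sum>g\<in>carrier G. indicator (carrier G - N) g * \<chi> g)"
    using rds unfolding rds_equation_def
    by (simp only: distrib_right sum.distrib sum_distrib_left mult.assoc)
  also have "\<dots> = of_nat (card D) + of_int lam * (\<Sum>g\<in>carrier G - N. \<chi> g)"
    by (subst (1 2) sum_indicator_mult) (auto simp: character_on_one[OF characters_on[OF \<chi>]])
  also have "(\<Sum>g\<in>carrier G - N. \<chi> g) = (\<Sum>x\<in>carrier G. \<chi> x) - (\<Sum>x\<in>N. \<chi> x)"
    using NG by (simp add: sum_diff)
  finally show ?thesis .
qed

end

section \<open>Orthonormal and mutually unbiased bases\<close>

text \<open>The product \<open>?A * ?B\<close> is the Gram matrix, hence the identity. So the
  determinant of \<open>?A\<close> is nonzero, and \<open>d\<close> independent vectors in dimension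
  \<open>d\<close> form a basis.\<close>

lemma orthonormal_basisI:
  assumes len: "length xs = d" and carr: "set xs \<subseteq> carrier_vec d"
    and orth: "\<And>i j. i < d \<Longrightarrow> j < d \<Longrightarrow> xs ! i \<bullet>c xs ! j = (if i = j then 1 else 0)"
  shows "orthonormal_basis d xs"
proof -
  interpret vec_space "TYPE(complex)" d .
  let ?A = "mat_of_rows d xs" and ?B = "mat_of_cols d (map conjugate xs)"
  have nth: "xs ! i \<in> carrier_vec d" if "i < d" for i using carr len that by (meson nth_mem subsetD)
  have A: "?A \<in> carrier_mat d d" and B: "?B \<in> carrier_mat d d" using len by auto
  have "?A * ?B = 1\<^sub>m d"
    by (rule eq_matI) (use len nth orth in auto)
  hence "det ?A * det ?B = 1" using det_mult[OF A B] by simp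
  hence "det ?A \<noteq> 0" by auto
  hence "lin_indpt (set (rows ?A))" by (rule det_not_0_imp_lin_indpt_rows[OF A])
  hence li: "lin_indpt (set xs)" using carr by simp
  have "distinct xs" unfolding distinct_conv_nth
    using orth len by (metis zero_neq_one)
  hence "basis (set xs)"
    by (intro dim_li_is_basis) (use li carr len dim_is_n in \<open>auto simp: distinct_card\<close>)
  thus ?thesis using len orth by (simp add: orthonormal_basis_def)
qed

lemma conjugate_unit_vec: "conjugate (unit_vec d i :: complex vec) = unit_vec d i"
  by (rule eq_vecI) (auto simp: unit_vec_def)

lemma orthonormal_basis_unit_vecs: "orthonormal_basis d (unit_vecs d)"
proof (rule orthonormal_basisI)
  show "set (unit_vecs d) \<subseteq> carrier_vec d" by (rule unit_vecs_carrier)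
  fix i j assume "i < d" "j < d"
  thus "unit_vecs d ! i \<bullet>c unit_vecs d ! j = (if i = j then 1 else (0::complex))"
    by (simp add: unit_vecs_def conjugate_unit_vec)
qed (simp add: unit_vecs_def)

text \<open>Inner products within one orthonormal basis have moduli 1 and 0, and both occur once
  \<open>d\<close> is at least 2.\<close>

lemma mutually_unbiased_neq:
  assumes "mutually_unbiased d xs ys" "2 \<le> d"
  shows "xs \<noteq> ys"
proof
  assume "xs = ys"
  with assms obtain a where a: "\<forall>i<d. \<forall>j<d. cmod (xs ! i \<bullet>c xs ! j) = a"
    and o: "orthonormal_basis d xs"
    unfolding mutually_unbiased_def by blast
  have "0 < d" "1 < d" using assms(2) by auto
  hence "cmod (xs ! 0 \<bullet>c xs ! 0) = cmod (xs ! 0 \<bullet>c xs ! 1)" using a by presburger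
  moreover have "xs ! 0 \<bullet>c xs ! 0 = 1" "xs ! 0 \<bullet>c xs ! 1 = 0"
    using o \<open>0 < d\<close> \<open>1 < d\<close> unfolding orthonormal_basis_def by auto
  ultimately show False by simp
qed

text \<open>Unbiasedness forces distinct indices to give distinct bases, so passing from a family to
  a set loses none.\<close>

lemma mub_set_image:
  assumes "2 \<le> d"
    and "\<And>i. i \<in> I \<Longrightarrow> orthonormal_basis d (b i)"
    and "\<And>i j. i \<in> I \<Longrightarrow> j \<in> I \<Longrightarrow> i \<noteq> j \<Longrightarrow> mutually_unbiased d (b i) (b j)"
  shows "mub_set d (b ` I)" "card (b ` I) = card I"
proof -
  have "inj_on b I" using assms mutually_unbiased_neq by (metis inj_onI)
  thus "card (b ` I) = card I" by (rule card_image)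
  show "mub_set d (b ` I)" unfolding mub_set_def pairwise_def using assms by blast
qed

text \<open>
  In dimension 1 different classes of characters can give the same vector, so this case needs its
  own family: any distinct complex numbers of modulus 1.
\<close>

lemma mub_set_dim_1: "\<exists>\<B>. mub_set 1 \<B> \<and> finite \<B> \<and> card \<B> = n + 1"
proof -
  \<comment> \<open>These roots of unity supply \<open>n + 1\<close> distinct numbers of modulus
    1.\<close>
  define Z where "Z = {z::complex. z ^ (n + 1) = 1}"
  define b :: "complex \<Rightarrow> complex vec list" where "b = (\<lambda>z. [vec 1 (\<lambda>_. z)])"
  have card: "card Z = n + 1" unfolding Z_def by (rule card_nth_roots) auto
  have fin: "finite Z" unfolding Z_def by (rule finite_nth_roots) simp
  have norm: "cmod z = 1" if "z \<in> Z" for z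
    using that unfolding Z_def
    by (intro norm_root_of_unity[of z "n + 1"]) auto
  have ip: "vec 1 (\<lambda>_. z) \<bullet>c vec 1 (\<lambda>_. w) = z * cnj w" for z w :: complex
    by (simp add: scalar_prod_def)
  have ortho: "orthonormal_basis 1 (b z)" if "z \<in> Z" for z
    by (rule orthonormal_basisI)
      (use norm[OF that] complex_norm_square[of z] in \<open>auto simp: b_def ip simp del: One_nat_def\<close>)
  have "mutually_unbiased 1 (b z) (b w)" if "z \<in> Z" "w \<in> Z" for z w
    unfolding mutually_unbiased_def
    using ortho that norm by (auto simp: b_def ip norm_mult simp del: One_nat_def)
  hence "mub_set 1 (b ` Z)" unfolding mub_set_def pairwise_def using ortho by blast
  moreover have "inj_on b Z" by (rule inj_onI) (auto simp: b_def dest!: arg_cong[of _ _ "\<lambda>v. v $ 0"])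
  ultimately show ?thesis using card fin card_image by (metis finite_imageI)
qed

section \<open>The bases given by a semi-regular relative difference set\<close>

text \<open>The list orders the coordinates; for a nonempty list of group elements the factor gives
  each character a unit vector.\<close>

definition character_vec :: "'g list \<Rightarrow> ('g \<Rightarrow> complex) \<Rightarrow> complex vec" where
  "character_vec ds \<chi> = vec (length ds) (\<lambda>j. \<chi> (ds ! j) / of_real (sqrt (length ds)))"

text \<open>Distinctness turns the sum over positions into one over the set; for characters the
  summand is the quotient character.\<close>

lemma character_vec_inner:
  assumes "distinct ds"
  shows "character_vec ds \<chi> \<bullet>c character_vec ds \<psi> =
    (\<Sum>x\<in>set ds. \<chi> x * cnj (\<psi> x)) / of_nat (length ds)"
proof -
  let ?s = "complex_of_real (sqrt (length ds))"
  have s: "?s * ?s = of_nat (length ds)"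
    by (simp flip: of_real_mult)
  have "character_vec ds \<chi> \<bullet>c character_vec ds \<psi> =
      (\<Sum>j<length ds. \<chi> (ds ! j) * cnj (\<psi> (ds ! j)) / (?s * ?s))"
    unfolding character_vec_def scalar_prod_def
    by (auto simp: lessThan_atLeast0 intro!: sum.cong)
  also have "\<dots> = (\<Sum>j<length ds. \<chi> (ds ! j) * cnj (\<psi> (ds ! j))) / of_nat (length ds)"
    unfolding s by (simp add: sum_divide_distrib)
  also have "(\<Sum>j<length ds. \<chi> (ds ! j) * cnj (\<psi> (ds ! j))) = (\<Sum>x\<in>set ds. \<chi> x * cnj (\<psi> x))"
    by (rule sum.reindex_bij_betw) (rule bij_betw_nth[OF assms refl refl])
  finally show ?thesis .
qed

text \<open>Dimension 1 is left to \<open>mub_set_dim_1\<close>.\<close>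

locale semiregular_rds_abelian = finite_abelian_group G for G (structure) +
  fixes N D :: "'a set" and n k :: nat and lam :: int
  assumes rds: "semiregular_rds G N D k n k lam" and k_ge_2: "2 \<le> k"
begin

lemma N: "subgroup N G" and D: "D \<subseteq> carrier G" and equation: "rds_equation G N D lam"
  and card_N: "card N = n" and card_G: "card (carrier G) = k * n" and card_D: "card D = k"
  using rds by (auto simp: semiregular_rds_def relative_difference_set_def normal_imp_subgroup)

lemma n_pos: "n > 0"
  using card_G one_closed fin by (metis card_eq_0_iff empty_iff gr0I mult_0_right)

text \<open>The difference set equation at the trivial character; the result can fail for \<open>k = 1\<close>.\<close>

lemma k_eq: "int k = lam * int n"
proof -
  let ?e = "\<lambda>x. if x \<in> carrier G then 1 else (0::complex)"
  have e: "?e \<in> characters G" by (auto simp: characters_def character_on_def)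
  have sum: "(\<Sum>x\<in>S. ?e x) = of_nat (card S)" if "S \<subseteq> carrier G" for S
    using that by (simp add: subset_iff sum.cong[of S S ?e "\<lambda>_. 1"])
  have "(of_nat k * of_nat k :: complex) = of_nat k + of_int lam * (of_nat (k * n) - of_nat n)"
    using rds_character_sum[OF equation N D e]
    by (simp only: sum[OF D] sum[OF subgroup.subset[OF N]] sum[OF order_refl]
        card_D card_N card_G complex_cnj_of_nat)
  hence "of_int (int k * int k) = (of_int (int k + lam * (int (k * n) - int n)) :: complex)"
    by simp
  hence "int k * int k = int k + lam * (int (k * n) - int n)" by (simp only: of_int_eq_iff)
  \<comment> \<open>The first factor is nonzero because \<open>k\<close> is at least 2, so the
    second one vanishes.\<close>
  hence "(int k - 1) * (int k - lam * int n) = 0" by (simp add: algebra_simps)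
  thus ?thesis using k_ge_2 by simp
qed

text \<open>Being nontrivial on \<open>N\<close>, and so on \<open>G\<close>, the character sums to
  0 over both; only |D| = k remains.\<close>

lemma character_sum_D_unbiased:
  assumes \<chi>: "\<chi> \<in> characters G" and "\<exists>x\<in>N. \<chi> x \<noteq> 1"
  shows "cmod (\<Sum>x\<in>D. \<chi> x) = sqrt k"
proof -
  have "\<exists>x\<in>carrier G. \<chi> x \<noteq> 1" using assms subgroup.subset[OF N] by blast
  hence "complex_of_real ((cmod (\<Sum>x\<in>D. \<chi> x))\<^sup>2) = of_real (real k)"
    unfolding complex_norm_square rds_character_sum[OF equation N D \<chi>]
      sum_character_subgroup[OF N \<chi>] sum_character_subgroup[OF subgroup_self \<chi>]
    using assms card_D by auto
  hence "(cmod (\<Sum>x\<in>D. \<chi> x))\<^sup>2 = real k" by (simp only: of_real_eq_iff)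
  thus ?thesis by (metis norm_ge_zero real_sqrt_unique)
qed

text \<open>The sum over \<open>G\<close> vanishes while that over \<open>N\<close> is
  \<open>n\<close>, so the squared modulus is k - lam n, which is 0 by \<open>k_eq\<close>.\<close>

lemma character_sum_D_orthogonal:
  assumes \<chi>: "\<chi> \<in> characters G" and "\<forall>x\<in>N. \<chi> x = 1" "\<exists>x\<in>carrier G. \<chi> x \<noteq> 1"
  shows "(\<Sum>x\<in>D. \<chi> x) = 0"
proof -
  have "(\<Sum>x\<in>D. \<chi> x) * cnj (\<Sum>x\<in>D. \<chi> x) = of_int (int k - lam * int n)"
    unfolding rds_character_sum[OF equation N D \<chi>]
      sum_character_subgroup[OF N \<chi>] sum_character_subgroup[OF subgroup_self \<chi>]
    using assms card_D card_N by auto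
  thus ?thesis using k_eq by (simp del: cnj_sum)
qed

definition restriction_class :: "('a \<Rightarrow> complex) \<Rightarrow> ('a \<Rightarrow> complex) set" where
  "restriction_class \<chi> = {\<psi>\<in>characters G. \<forall>x\<in>N. \<psi> x = \<chi> x}"

lemma card_restriction_class_N:
  assumes "\<chi> \<in> characters G"
  shows "card (restriction_class \<chi>) = k"
  using card_restriction_class[OF N assms] n_pos
  by (simp add: restriction_class_def card_N card_G mult.commute)

lemma mub_set_exists: "\<exists>\<B>. mub_set k \<B> \<and> finite \<B> \<and> card \<B> = n + 1"
proof -
  obtain ds where ds: "distinct ds" "set ds = D"
    using finite_distinct_list finite_subset[OF D fin] by blast
  have len: "length ds = k" using ds card_D distinct_card by metis
  have dG: "ds ! j \<in> carrier G" if "j < k" for j using that ds D len by (metis nth_mem subsetD)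
  let ?v = "character_vec ds"
  have ip: "?v \<chi> \<bullet>c ?v \<psi> = (\<Sum>x\<in>D. \<chi> x * cnj (\<psi> x)) / of_nat k" for \<chi> \<psi>
    using character_vec_inner[OF ds(1)] by (simp add: ds len)
  have quot: "(\<lambda>x. \<chi> x * cnj (\<psi> x)) \<in> characters G" if "\<chi> \<in> characters G" "\<psi> \<in> characters G" for \<chi> \<psi>
    using that by (intro characters_mult characters_cnj_closed)
  have quot_1: "\<chi> x * cnj (\<psi> x) = 1 \<longleftrightarrow> \<chi> x = \<psi> x"
    if "\<chi> \<in> characters G" "\<psi> \<in> characters G" "x \<in> carrier G" for \<chi> \<psi> x
    using characters_cnj[OF that(2,3)] by (metis mult_cancel_right mult_zero_right zero_neq_one)
  have NG: "x \<in> carrier G" if "x \<in> N" for x using N that by (rule subgroup.mem_carrier)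
  define \<C> where "\<C> = restriction_class ` characters G"
  have "finite C" if "C \<in> \<C>" for C
    using that finite_characters by (auto simp: \<C>_def restriction_class_def)
  hence "\<forall>C\<in>\<C>. \<exists>l. set l = C \<and> distinct l" using finite_distinct_list by blast
  \<comment> \<open>A basis is a list, so an order is chosen for each class.\<close>
  then obtain L where L: "\<And>C. C \<in> \<C> \<Longrightarrow> set (L C) = C" "\<And>C. C \<in> \<C> \<Longrightarrow> distinct (L C)" by metis
  have lenL: "length (L C) = k" if C: "C \<in> \<C>" for C
    using L[OF C] C card_restriction_class_N distinct_card unfolding \<C>_def by fastforce
  have mem: "L C ! i \<in> C" "L C ! i \<in> characters G" if "C \<in> \<C>" "i < k" for C i
  proof -
    show *: "L C ! i \<in> C" using that L lenL by (metis nth_mem)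
    thus "L C ! i \<in> characters G" using that by (auto simp: \<C>_def restriction_class_def)
  qed
  \<comment> \<open>\<open>None\<close> marks the standard basis, \<open>Some C\<close> the basis of
    the class \<open>C\<close>.\<close>
  define b where "b c = (case c of None \<Rightarrow> unit_vecs k | Some C \<Rightarrow> map ?v (L C))" for c
  have b_char: "orthonormal_basis k (map ?v (L C))" if C: "C \<in> \<C>" for C
  proof (rule orthonormal_basisI)
    show "set (map ?v (L C)) \<subseteq> carrier_vec k" by (auto simp: character_vec_def len)
    fix i j assume ij: "i < k" "j < k"
    \<comment> \<open>Conjugation inverts character values, so this is the quotient of the two
      characters.\<close>
    let ?\<phi> = "\<lambda>x. (L C ! i) x * cnj ((L C ! j) x)"
    have "(\<Sum>x\<in>D. ?\<phi> x) = (if i = j then of_nat k else 0)"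
    proof (cases "i = j")
      case True
      have "(\<Sum>x\<in>D. ?\<phi> x) = (\<Sum>x\<in>D. 1)"
        using True characters_cnj[OF mem(2)[OF C ij(1)]] D by (intro sum.cong) auto
      thus ?thesis using True card_D by simp
    next
      case False
      hence "L C ! i \<noteq> L C ! j" using L(2)[OF C] lenL[OF C] ij by (simp add: nth_eq_iff_index_eq)
      hence "\<exists>x\<in>carrier G. (L C ! i) x \<noteq> (L C ! j) x"
        using characters_eqI[OF mem(2)[OF C ij(1)] mem(2)[OF C ij(2)]] by blast
      hence "\<exists>x\<in>carrier G. ?\<phi> x \<noteq> 1"
        using quot_1[OF mem(2)[OF C ij(1)] mem(2)[OF C ij(2)]] by blast
      \<comment> \<open>Members of one class agree on \<open>N\<close>, so their quotient is trivial
        there.\<close>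
      moreover have "\<forall>x\<in>N. (L C ! i) x = (L C ! j) x"
        using mem(1)[OF C ij(1)] mem(1)[OF C ij(2)] C by (auto simp: \<C>_def restriction_class_def)
      hence "\<forall>x\<in>N. ?\<phi> x = 1"
        using quot_1[OF mem(2)[OF C ij(1)] mem(2)[OF C ij(2)]] NG by blast
      ultimately show ?thesis
        using character_sum_D_orthogonal[OF quot[OF mem(2)[OF C ij(1)] mem(2)[OF C ij(2)]]] False
        by simp
    qed
    thus "map ?v (L C) ! i \<bullet>c map ?v (L C) ! j = (if i = j then 1 else 0)"
      using ij lenL[OF C] k_ge_2 by (simp add: ip)
  qed (simp add: lenL[OF C])
  have b_ortho: "orthonormal_basis k (b c)" if "c \<in> insert None (Some ` \<C>)" for c
    using that b_char orthonormal_basis_unit_vecs by (auto simp: b_def)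
  \<comment> \<open>The inner product with a unit vector picks out one coordinate up to conjugation,
    and its modulus is 1 / sqrt k.\<close>
  have ub_unit: "cmod (unit_vec k i \<bullet>c ?v \<chi>) = 1 / sqrt k" "cmod (?v \<chi> \<bullet>c unit_vec k i) = 1 / sqrt k"
    if "i < k" "\<chi> \<in> characters G" for i \<chi>
  proof -
    have c: "?v \<chi> \<in> carrier_vec k" by (simp add: character_vec_def len)
    show "cmod (unit_vec k i \<bullet>c ?v \<chi>) = 1 / sqrt k" "cmod (?v \<chi> \<bullet>c unit_vec k i) = 1 / sqrt k"
      using that c characters_norm[OF that(2) dG[OF that(1)]]
      by (simp_all add: conjugate_unit_vec) (simp_all add: character_vec_def len norm_divide)
  qed
  \<comment> \<open>The quotient is nontrivial on \<open>N\<close>, so the modulus is sqrt k /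
    k.\<close>
  have ub_char: "cmod (?v \<chi> \<bullet>c ?v \<psi>) = 1 / sqrt k"
    if "\<chi> \<in> characters G" "\<psi> \<in> characters G" "\<exists>x\<in>N. \<chi> x \<noteq> \<psi> x" for \<chi> \<psi>
  proof -
    have "\<exists>x\<in>N. \<chi> x * cnj (\<psi> x) \<noteq> 1" using that(3) quot_1[OF that(1,2)] NG by blast
    from character_sum_D_unbiased[OF quot[OF that(1,2)] this] show ?thesis
      using k_ge_2 by (simp add: ip norm_divide real_div_sqrt field_simps)
  qed
  have unbiased: "mutually_unbiased k (b c) (b c')"
    if c: "c \<in> insert None (Some ` \<C>)" "c' \<in> insert None (Some ` \<C>)" "c \<noteq> c'" for c c'
  proof -
    have "cmod (b c ! i \<bullet>c b c' ! j) = 1 / sqrt k" if ij: "i < k" "j < k" for i j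
    proof (cases c)
      case None
      then obtain C where "c' = Some C" "C \<in> \<C>" using c by auto
      thus ?thesis using None ub_unit(1)[OF ij(1) mem(2)] ij lenL
        by (simp add: b_def unit_vecs_def)
    next
      case (Some C)
      hence C: "C \<in> \<C>" using c by auto
      show ?thesis
      proof (cases c')
        case None
        thus ?thesis using Some C ub_unit(2)[OF ij(2) mem(2)] ij lenL
          by (simp add: b_def unit_vecs_def)
      next
        case C': (Some C')
        hence C'': "C' \<in> \<C>" "C \<noteq> C'" using c Some by auto
        \<comment> \<open>Equal restrictions to \<open>N\<close> would make the two classes
          equal.\<close>
        have "\<exists>x\<in>N. (L C ! i) x \<noteq> (L C' ! j) x"
          using mem(1)[OF C ij(1)] mem(1)[OF C''(1) ij(2)] C C''
          by (auto simp: \<C>_def restriction_class_def)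
        thus ?thesis
          using ub_char[OF mem(2)[OF C ij(1)] mem(2)[OF C''(1) ij(2)]] Some C' ij lenL C C''
          by (simp add: b_def)
      qed
    qed
    thus ?thesis unfolding mutually_unbiased_def using b_ortho c by blast
  qed
  \<comment> \<open>One index for \<open>None\<close> and \<open>n\<close> for the classes give the
    count \<open>n + 1\<close>.\<close>
  note mub_set_image[where b = b and I = "insert None (Some ` \<C>)", OF k_ge_2 b_ortho unbiased]
  moreover have "finite \<C>" by (simp add: \<C>_def finite_characters)
  moreover have "card \<C> = n"
    using card_restriction_classes[OF N] card_N by (simp add: \<C>_def restriction_class_def)
  ultimately show ?thesis
    by (intro exI[of _ "b ` insert None (Some ` \<C>)"]) (simp add: card_image)
qed

end

theorem theorem4p1:
  fixes G :: "('g, 'b) monoid_scheme"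
    and N D :: "'g set"
    and n k :: nat
    and lam :: int
  assumes "comm_group G"
    and "finite (carrier G)"
    and "semiregular_rds G N D k n k lam"
  shows "\<exists>\<B>. mub_set k \<B> \<and> finite \<B> \<and> card \<B> = n + 1"
proof -
  interpret finite_abelian_group G
    using assms by (simp add: finite_abelian_group_def finite_abelian_group_axioms_def)
  have "card (carrier G) = k * n"
    using assms(3) by (simp add: semiregular_rds_def relative_difference_set_def)
  hence "k \<noteq> 0" using one_closed fin by (metis card_eq_0_iff empty_iff mult_0)
  \<comment> \<open>Dimension 1 is split off because there the character bases need not be
    distinct.\<close>
  then consider "k = 1" | "2 \<le> k" by linarith
  thus ?thesis
  proof cases
    case 1
    thus ?thesis using mub_set_dim_1 by simp
  next
    case 2
    interpret semiregular_rds_abelian G N D n k lam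
      by unfold_locales (use assms 2 in auto)
    show ?thesis by (rule mub_set_exists)
  qed
qed

end
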